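(* Let $f_1,\ldots,f_r,g_1,\ldots,g_s\in\mathbb{R}[\mathbf{x}]$, $\mathbf{x}=(x_1,\ldots,x_n)$, be concave quadratic polynomials such that the set $K=\{\mathbf{x}\in\mathbb{R}^n\mid f_1(\mathbf{x})\ge0,\ldots,f_r(\mathbf{x})\ge0,\ g_1(\mathbf{x})>0,\ldots,g_s(\mathbf{x})>0\}$ is empty. Suppose that there do not exist $\delta_1,\ldots,\delta_r\ge0$ such that $-(\delta_1f_1+\cdots+\delta_rf_r)$ is a nonzero sum of squares of polynomials. Then there exist $\lambda_1,\ldots,\lambda_r\ge0$, $\eta_0,\eta_1,\ldots,\eta_s\ge0$ and a sum-of-squares polynomial $h\in\mathbb{R}[\mathbf{x}]$ of degree at most $2$ such that $$\sum_{i=1}^r\lambda_if_i+\sum_{j=1}^s\eta_jg_j+\eta_0+h\equiv0\quad\text{and}\quad \eta_0+\eta_1+\cdots+\eta_s=1.$$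
   Context: A polynomial $f\in\mathbb{R}[\mathbf{x}]$ is concave quadratic (CQ) if it has total degree at most 2, i.e. $f=\mathbf{x}^TA\mathbf{x}+2\vec\alpha^T\mathbf{x}+a$ with $A$ real symmetric, and $A$ is negative semidefinite. A sum-of-squares (SOS) polynomial is a finite sum of squares of real polynomials. *)

theory Defs
  imports "HOL-Analysis.Analysis" "HOL-Library.Poly_Mapping"
begin

text \<open>
  The polynomial ring over the reals in variables indexed by a finite type: a polynomial maps
  monomials (exponent vectors) to coefficients and is zero on all but finitely many of them.
  Addition and multiplication are those of \<^theory>\<open>HOL-Library.Poly_Mapping\<close>; multiplication
  is convolution.
\<close>
type_synonym 'n rpoly = "('n \<Rightarrow>\<^sub>0 nat) \<Rightarrow>\<^sub>0 real"

definition Const :: "real \<Rightarrow> 'n rpoly" where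
  "Const c = Poly_Mapping.single 0 c"

definition Var :: "'n \<Rightarrow> 'n rpoly" where
  "Var i = Poly_Mapping.single (Poly_Mapping.single i 1) 1"

definition peval :: "('n::finite) rpoly \<Rightarrow> real ^ 'n \<Rightarrow> real" where
  "peval p x =
     (\<Sum>m\<in>Poly_Mapping.keys p.
        Poly_Mapping.lookup p m * (\<Prod>i\<in>UNIV. x $ i ^ Poly_Mapping.lookup m i))"

text \<open>The zero polynomial gets total degree 0.\<close>
definition total_degree :: "('n::finite) rpoly \<Rightarrow> nat" where
  "total_degree p =
     Max (insert 0 ((\<lambda>m. \<Sum>i\<in>UNIV. Poly_Mapping.lookup m i) ` Poly_Mapping.keys p))"

definition negative_semidefinite :: "real ^ 'n ^ 'n \<Rightarrow> bool" where
  "negative_semidefinite A \<longleftrightarrow> transpose A = A \<and> (\<forall>x. x \<bullet> (A *v x) \<le> 0)"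

text \<open>
  An identity in the polynomial ring. A polynomial has total degree at most 2 if and only if it
  has this form for some symmetric matrix, so no separate degree bound is needed.
\<close>
definition concave_quadratic :: "('n::finite) rpoly \<Rightarrow> bool" where
  "concave_quadratic f \<longleftrightarrow>
     (\<exists>(A :: real ^ 'n ^ 'n) (\<alpha> :: real ^ 'n) (a :: real).
        negative_semidefinite A \<and>
        f = (\<Sum>i\<in>UNIV. \<Sum>j\<in>UNIV. Const (A $ i $ j) * Var i * Var j)
            + 2 * (\<Sum>i\<in>UNIV. Const (\<alpha> $ i) * Var i) + Const a)"

definition sos :: "'n rpoly \<Rightarrow> bool" where
  "sos p \<longleftrightarrow> (\<exists>qs :: 'n rpoly list. p = (\<Sum>q\<leftarrow>qs. q ^ 2))"

end

theory Submission
  imports Defs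
begin

text \<open>
  A polynomial of degree at most 2 in \<open>n\<close> variables is encoded by a symmetric matrix over the
  \<open>n + 1\<close> indices \<^typ>\<open>'n option\<close>, where \<^const>\<open>None\<close> is the constant coordinate; sums of squares
  correspond to positive semidefinite matrices. Because no \<open>-\<Sum>\<delta>\<^sub>i f\<^sub>i\<close> is a nonzero sum of squares,
  \<open>C = cone {f\<^sub>1, \<dots>, f\<^sub>r} + SOS\<close> is closed. If the compact convex set \<open>D = conv {-1, -g\<^sub>1, \<dots>, -g\<^sub>s}\<close>
  missed \<open>C\<close>, a linear functional \<open>L\<close> would be nonnegative on \<open>C\<close> and negative on \<open>D\<close>. For
  \<open>x = L(\<^bold>x) / L(1)\<close> and \<open>f\<close> concave quadratic with quadratic part \<open>A\<close>, the polynomial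
  \<open>-(\<^bold>x - x)\<^sup>T A (\<^bold>x - x)\<close> is a sum of squares, whence \<open>f(x) \<ge> L(f) / L(1)\<close>, and \<open>x\<close> would lie in \<open>K\<close>.
\<close>

section \<open>Closed cones and finitely generated hulls\<close>

text \<open>Unit vectors of \<open>A\<close> keep a positive distance \<open>d\<close> from
  \<open>- B\<close>, so scaling gives \<open>d * norm a \<le> norm (a + b)\<close>. A convergent
  sequence of sums therefore has bounded \<open>A\<close>-summands; a convergent subsequence of
  these splits the limit.\<close>

lemma closed_conic_sums:
  fixes A B :: "'a::euclidean_space set"
  assumes "conic A" "closed A" "conic B" "closed B"
    and trivial: "\<And>a. \<lbrakk>a \<in> A; - a \<in> B\<rbrakk> \<Longrightarrow> a = 0"
  shows "closed {a + b |a b. a \<in> A \<and> b \<in> B}"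
proof -
  have "compact (A \<inter> sphere 0 1)"
    using \<open>closed A\<close> by (simp add: closed_Int_compact)
  moreover have "closed (uminus ` B)"
    using \<open>closed B\<close> by (rule closed_negations)
  moreover have "(A \<inter> sphere 0 1) \<inter> uminus ` B = {}"
    using trivial by fastforce
  ultimately obtain d where "d > 0"
    and d: "\<And>x y. \<lbrakk>x \<in> A \<inter> sphere 0 1; y \<in> uminus ` B\<rbrakk> \<Longrightarrow> d \<le> dist x y"
    by (metis separate_compact_closed)
  have bound: "d * norm a \<le> norm (a + b)" if "a \<in> A" "b \<in> B" for a b
  proof (cases "a = 0")
    case False
    let ?c = "1 / norm a"
    have "?c *\<^sub>R a \<in> A \<inter> sphere 0 1"
      using that False \<open>conic A\<close> by (simp add: conic_mul)
    moreover have "- (?c *\<^sub>R b) \<in> uminus ` B"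
      using that \<open>conic B\<close> by (simp add: conic_mul)
    ultimately have "d \<le> norm (?c *\<^sub>R a + ?c *\<^sub>R b)"
      using d by (fastforce simp: dist_norm)
    also have "\<dots> = ?c * norm (a + b)"
      by (simp flip: scaleR_add_right)
    finally show ?thesis
      using False by (simp add: pos_le_divide_eq)
  qed simp
  show ?thesis
    unfolding closed_sequential_limits
  proof (intro allI impI, elim conjE)
    fix z l
    assume z: "\<forall>n. z n \<in> {a + b |a b. a \<in> A \<and> b \<in> B}" and lim: "z \<longlonglongrightarrow> l"
    then obtain a b where ab: "\<And>n. a n \<in> A" "\<And>n. b n \<in> B" "\<And>n. z n = a n + b n"
      by simp metis
    obtain R where R: "\<And>n. norm (z n) \<le> R"
      using lim convergent_imp_Bseq by (metis Bseq_def convergentI)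
    have "norm (a n) \<le> R / d" for n
      using bound[OF ab(1,2), of n n] R[of n] \<open>d > 0\<close> ab(3)[of n]
      by (simp add: field_simps)
    then have "\<And>n. a n \<in> A \<inter> cball 0 (R / d)"
      using ab by simp
    moreover have "compact (A \<inter> cball 0 (R / d))"
      using \<open>closed A\<close> by (simp add: closed_Int_compact)
    ultimately obtain a' \<rho> where a': "a' \<in> A" "strict_mono \<rho>" "(a \<circ> \<rho>) \<longlonglongrightarrow> a'"
      unfolding compact_def by (metis IntD1)
    have "(\<lambda>n. (z \<circ> \<rho>) n - (a \<circ> \<rho>) n) \<longlonglongrightarrow> l - a'"
      using tendsto_diff[OF LIMSEQ_subseq_LIMSEQ[OF lim a'(2)] a'(3)] by simp
    then have "(b \<circ> \<rho>) \<longlonglongrightarrow> l - a'"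
      using ab by (simp add: o_def)
    then have "l - a' \<in> B"
      using \<open>closed B\<close> ab by (metis closed_sequentially comp_apply)
    then show "l \<in> {a + b |a b. a \<in> A \<and> b \<in> B}"
      using a' by (intro CollectI exI[of _ a'] exI[of _ "l - a'"]) simp
  qed
qed

text \<open>Coefficients are indexed by \<open>I\<close> rather than by points of the image, so
  repeated values of \<open>F\<close> need no care.\<close>

lemma convex_cone_hull_image_subset:
  assumes "finite I"
  shows "convex_cone hull (F ` I) \<subseteq> {\<Sum>i\<in>I. c i *\<^sub>R F i |c. \<forall>i\<in>I. (0::real) \<le> c i}"
proof (rule hull_minimal)
  have "F i \<in> {\<Sum>i\<in>I. c i *\<^sub>R F i |c. \<forall>i\<in>I. 0 \<le> c i}" if "i \<in> I" for i
    using that assms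
    by (intro CollectI exI[of _ "\<lambda>j. if j = i then 1 else 0"]) (simp add: if_distrib[of "\<lambda>c. c *\<^sub>R _"] cong: if_cong)
  then show "F ` I \<subseteq> {\<Sum>i\<in>I. c i *\<^sub>R F i |c. \<forall>i\<in>I. 0 \<le> c i}"
    by blast
  show "convex_cone {\<Sum>i\<in>I. c i *\<^sub>R F i |c. \<forall>i\<in>I. 0 \<le> c i}"
    unfolding convex_cone_iff
  proof (intro conjI ballI allI impI)
    show "0 \<in> {\<Sum>i\<in>I. c i *\<^sub>R F i |c. \<forall>i\<in>I. 0 \<le> c i}"
      by (intro CollectI exI[of _ "\<lambda>_. 0"]) simp
    fix x assume "x \<in> {\<Sum>i\<in>I. c i *\<^sub>R F i |c. \<forall>i\<in>I. 0 \<le> c i}"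
    then obtain c where c: "x = (\<Sum>i\<in>I. c i *\<^sub>R F i)" "\<forall>i\<in>I. 0 \<le> c i" by blast
    { fix y assume "y \<in> {\<Sum>i\<in>I. c i *\<^sub>R F i |c. \<forall>i\<in>I. 0 \<le> c i}"
      then obtain d where d: "y = (\<Sum>i\<in>I. d i *\<^sub>R F i)" "\<forall>i\<in>I. 0 \<le> d i" by blast
      show "x + y \<in> {\<Sum>i\<in>I. c i *\<^sub>R F i |c. \<forall>i\<in>I. 0 \<le> c i}"
        using c d by (intro CollectI exI[of _ "\<lambda>i. c i + d i"])
          (simp add: scaleR_add_left sum.distrib) }
    { fix k :: real assume "0 \<le> k"
      then show "k *\<^sub>R x \<in> {\<Sum>i\<in>I. c i *\<^sub>R F i |c. \<forall>i\<in>I. 0 \<le> c i}"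
        using c by (intro CollectI exI[of _ "\<lambda>i. k * c i"])
          (simp add: scaleR_right.sum) }
  qed
qed

lemma convex_hull_image_subset:
  assumes "finite I"
  shows "convex hull (F ` I)
    \<subseteq> {\<Sum>i\<in>I. c i *\<^sub>R F i |c. (\<forall>i\<in>I. (0::real) \<le> c i) \<and> sum c I = 1}"
proof (rule hull_minimal)
  have "F i \<in> {\<Sum>i\<in>I. c i *\<^sub>R F i |c. (\<forall>i\<in>I. 0 \<le> c i) \<and> sum c I = 1}" if "i \<in> I" for i
    using that assms
    by (intro CollectI exI[of _ "\<lambda>j. if j = i then 1 else 0"])
      (simp add: if_distrib[of "\<lambda>c. c *\<^sub>R _"] cong: if_cong)
  then show "F ` I \<subseteq> {\<Sum>i\<in>I. c i *\<^sub>R F i |c. (\<forall>i\<in>I. 0 \<le> c i) \<and> sum c I = 1}"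
    by blast
  show "convex {\<Sum>i\<in>I. c i *\<^sub>R F i |c. (\<forall>i\<in>I. 0 \<le> c i) \<and> sum c I = 1}"
    unfolding convex_def
  proof (intro ballI allI impI)
    fix x y and u v :: real
    assume "x \<in> {\<Sum>i\<in>I. c i *\<^sub>R F i |c. (\<forall>i\<in>I. 0 \<le> c i) \<and> sum c I = 1}"
      and "y \<in> {\<Sum>i\<in>I. c i *\<^sub>R F i |c. (\<forall>i\<in>I. 0 \<le> c i) \<and> sum c I = 1}"
      and uv: "0 \<le> u" "0 \<le> v" "u + v = 1"
    then obtain c d where "x = (\<Sum>i\<in>I. c i *\<^sub>R F i)" "\<forall>i\<in>I. 0 \<le> c i" "sum c I = 1"
      and "y = (\<Sum>i\<in>I. d i *\<^sub>R F i)" "\<forall>i\<in>I. 0 \<le> d i" "sum d I = 1"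
      by blast
    then show "u *\<^sub>R x + v *\<^sub>R y \<in> {\<Sum>i\<in>I. c i *\<^sub>R F i |c. (\<forall>i\<in>I. 0 \<le> c i) \<and> sum c I = 1}"
      using uv by (intro CollectI exI[of _ "\<lambda>i. u * c i + v * d i"])
        (simp add: scaleR_add_left sum.distrib scaleR_right.sum flip: sum_distrib_left)
  qed
qed

section \<open>Positive semidefinite matrices and rank-one decompositions\<close>

definition psd :: "real ^ 'm ^ 'm \<Rightarrow> bool" where
  "psd M \<longleftrightarrow> transpose M = M \<and> (\<forall>x. 0 \<le> x \<bullet> (M *v x))"

definition outer :: "real ^ 'm \<Rightarrow> real ^ 'm ^ 'm" where
  "outer v = (\<chi> i j. v $ i * v $ j)"

lemma inner_symmetric_matrix:
  fixes M :: "real ^ 'm ^ 'm"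
  assumes "transpose M = M"
  shows "x \<bullet> (M *v y) = y \<bullet> (M *v x)"
  by (metis assms dot_lmul_matrix inner_commute transpose_matrix_vector)

lemma inner_symmetric_matrix_combination:
  fixes M :: "real ^ 'm ^ 'm"
  assumes "transpose M = M"
  shows "(x + c *\<^sub>R y) \<bullet> (M *v (x + c *\<^sub>R y))
    = x \<bullet> (M *v x) + 2 * c * (y \<bullet> (M *v x)) + c\<^sup>2 * (y \<bullet> (M *v y))"
  using inner_symmetric_matrix[OF assms, of x y]
  by (simp add: inner_add_left inner_add_right matrix_vector_right_distrib
      matrix_vector_mult_scaleR power2_eq_square algebra_simps)

lemma transpose_eq_iff: "transpose M = M \<longleftrightarrow> (\<forall>i j. M $ i $ j = M $ j $ i)"
  by (auto simp: transpose_def vec_eq_iff)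

lemma outer_mult_vec: "outer v *v x = (v \<bullet> x) *\<^sub>R v"
  by (simp add: outer_def matrix_vector_mult_def vec_eq_iff inner_vec_def sum_distrib_left
      sum_distrib_right ac_simps)

text \<open>Along the line \<open>y + t *\<^sub>R (M *v y)\<close> the form equals
  \<open>2 * t * w + t\<^sup>2 * c\<close> with \<open>w\<close> the squared norm of
  \<open>M *v y\<close>. Nonnegativity for small negative \<open>t\<close> forces
  \<open>w = 0\<close>.\<close>

lemma psd_mult_vec_eq_0:
  fixes M :: "real ^ 'm ^ 'm"
  assumes "psd M" "y \<bullet> (M *v y) = 0"
  shows "M *v y = 0"
proof -
  let ?x = "M *v y"
  define w c where "w = ?x \<bullet> ?x" and "c = ?x \<bullet> (M *v ?x)"
  have "c \<ge> 0"
    using assms by (simp add: c_def psd_def)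
  have "0 \<le> 2 * t * w + t\<^sup>2 * c" for t
    using assms inner_symmetric_matrix_combination[of M y t ?x]
    by (metis add_0 c_def psd_def w_def)
  \<comment> \<open>The denominator \<open>c + 1\<close> replaces the minimizer's \<open>c\<close>,
    which may be 0.\<close>
  from this[of "- w / (c + 1)"] have "0 \<le> - (w\<^sup>2 * (c + 2)) / (c + 1)\<^sup>2"
    using \<open>c \<ge> 0\<close> by (simp add: power2_eq_square divide_simps) (simp add: algebra_simps)
  then have "w\<^sup>2 * (c + 2) \<le> 0"
    using \<open>c \<ge> 0\<close> by (simp add: divide_simps zero_less_power split: if_splits)
  then have "w = 0"
    using \<open>c \<ge> 0\<close> by (simp add: mult_le_0_iff)
  then show ?thesis
    by (simp add: w_def)
qed

lemma inner_axis_matrix: "axis i 1 \<bullet> ((M :: real ^ 'm ^ 'm) *v axis j 1) = M $ i $ j"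
  by (simp add: inner_axis' matrix_vector_mul_component inner_axis)

text \<open>Symmetric Gaussian elimination: subtracting a rank-one matrix clears one diagonal entry.\<close>
lemma psd_sum_outer:
  fixes M :: "real ^ 'm ^ 'm"
  assumes "psd M"
  shows "\<exists>vs. M = (\<Sum>v\<leftarrow>vs. outer v)"
  using assms
proof (induction "card {j. M $ j $ j \<noteq> 0}" arbitrary: M rule: less_induct)
  case less
  \<comment> \<open>A zero diagonal entry kills its whole column. Hence the elimination below leaves
    such entries zero and the number of nonzero diagonal entries drops.\<close>
  have zero: "M *v axis j 1 = 0" if "M $ j $ j = 0" for j
    using psd_mult_vec_eq_0[OF less.prems] that by (simp add: inner_axis_matrix)
  have sym: "transpose M = M"
    using less.prems by (simp add: psd_def)
  show ?case
  proof (cases "\<exists>i. M $ i $ i \<noteq> 0")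
    case False
    then have "M $ i $ j = 0" for i j
      using zero[of j] by (metis inner_axis_matrix inner_zero_right)
    then show ?thesis
      by (intro exI[of _ "[]"]) (simp add: vec_eq_iff)
  next
    case True
    then obtain i where i: "M $ i $ i \<noteq> 0" by blast
    define k u where "k = M $ i $ i" and "u = M *v axis i 1"
    have "k > 0"
      using i less.prems inner_axis_matrix[of i M i] unfolding k_def psd_def
      by (metis order_le_less)
    have uj: "u $ j = M $ j $ i" for j
      by (metis inner_axis' inner_axis_matrix mult_1 u_def inner_real_def)
    define v where "v = (1 / sqrt k) *\<^sub>R u"
    define M' where "M' = M - outer v"
    have M': "M' $ a $ b = M $ a $ b - u $ a * u $ b / k" for a b
      using \<open>k > 0\<close> by (simp add: M'_def v_def outer_def)
    have "0 \<le> x \<bullet> (M' *v x)" for x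
    proof -
      \<comment> \<open>This \<open>?c\<close> minimizes the form of \<open>M\<close> on the line
        through \<open>x\<close> in direction \<open>axis i 1\<close>; the minimum is exactly the
        form of \<open>M'\<close> at \<open>x\<close>.\<close>
      let ?c = "- (u \<bullet> x) / k"
      have "0 \<le> (x + ?c *\<^sub>R axis i 1) \<bullet> (M *v (x + ?c *\<^sub>R axis i 1))"
        using less.prems by (simp add: psd_def)
      also have "\<dots> = x \<bullet> (M *v x) + 2 * ?c * (x \<bullet> u) + ?c\<^sup>2 * k"
        unfolding inner_symmetric_matrix_combination[OF sym] k_def inner_axis_matrix u_def
        by (simp add: inner_symmetric_matrix[OF sym, of "axis i 1" x])
      also have "\<dots> = x \<bullet> (M *v x) - (u \<bullet> x)\<^sup>2 / k"
        using \<open>k > 0\<close> by (simp add: power2_eq_square inner_commute divide_simps)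
      also have "\<dots> = x \<bullet> (M' *v x)"
        using \<open>k > 0\<close>
        by (simp add: M'_def v_def outer_mult_vec matrix_vector_mult_diff_rdistrib inner_diff_right
            power2_eq_square inner_commute)
      finally show ?thesis .
    qed
    moreover have "transpose M' = M'"
      using sym by (simp add: transpose_eq_iff M' mult.commute)
    ultimately have "psd M'"
      by (simp add: psd_def)
    have "u $ j = 0" if "M $ j $ j = 0" for j
      using zero[OF that] sym unfolding uj transpose_eq_iff
      by (metis inner_axis_matrix inner_zero_right)
    then have "{j. M' $ j $ j \<noteq> 0} \<subseteq> {j. M $ j $ j \<noteq> 0}"
      by (auto simp: M')
    moreover have "M' $ i $ i = 0"
      using \<open>k > 0\<close> by (simp add: M' uj k_def)
    ultimately have "{j. M' $ j $ j \<noteq> 0} \<subset> {j. M $ j $ j \<noteq> 0}"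
      using i by blast
    then have "card {j. M' $ j $ j \<noteq> 0} < card {j. M $ j $ j \<noteq> 0}"
      by (simp add: psubset_card_mono)
    from less.hyps[OF this \<open>psd M'\<close>] obtain vs where "M' = (\<Sum>v\<leftarrow>vs. outer v)" by blast
    then show ?thesis
      by (intro exI[of _ "v # vs"]) (simp add: M'_def algebra_simps)
  qed
qed

lemma closed_psd: "closed {M :: real ^ 'm ^ 'm. psd M}"
proof -
  have "{M :: real ^ 'm ^ 'm. psd M}
    = (\<Inter>i. \<Inter>j. {M. M $ i $ j = M $ j $ i}) \<inter> (\<Inter>x. {M. 0 \<le> x \<bullet> (M *v x)})"
    by (auto simp: psd_def transpose_eq_iff)
  also have "closed \<dots>"
    by (intro closed_Int closed_INT ballI closed_Collect_eq closed_Collect_le)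
      (auto simp: matrix_vector_mult_def inner_vec_def intro!: continuous_intros)
  finally show ?thesis .
qed

lemma psd_scaleR: "psd M \<Longrightarrow> 0 \<le> c \<Longrightarrow> psd (c *\<^sub>R M)"
  by (simp add: psd_def transpose_eq_iff flip: scaleR_matrix_vector_assoc)

lemma convex_cone_psd: "convex_cone {M :: real ^ 'm ^ 'm. psd M}"
  unfolding convex_cone_iff
  by (auto simp: psd_scaleR) (auto simp: psd_def transpose_eq_iff matrix_vector_mult_add_rdistrib inner_add_right)

section \<open>Polynomials of degree at most 2 as matrices\<close>

definition homog_mon :: "'n option \<Rightarrow> ('n \<Rightarrow>\<^sub>0 nat)" where
  "homog_mon i = (case i of None \<Rightarrow> 0 | Some k \<Rightarrow> Poly_Mapping.single k 1)"

definition homog_vec :: "real ^ 'n \<Rightarrow> real ^ 'n option" where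
  "homog_vec x = (\<chi> i. case i of None \<Rightarrow> 1 | Some k \<Rightarrow> x $ k)"

text \<open>The quadratic form of \<open>M\<close> in the vector of monomials 1, x_1, ..., x_n; the
  entries at \<open>(i, j)\<close> and \<open>(j, i)\<close> add up in one coefficient.\<close>

definition quad_poly :: "real ^ ('n::finite) option ^ 'n option \<Rightarrow> 'n rpoly" where
  "quad_poly M = (\<Sum>i\<in>UNIV. \<Sum>j\<in>UNIV. Poly_Mapping.single (homog_mon i + homog_mon j) (M $ i $ j))"

lemma quad_poly_0: "quad_poly 0 = 0"
  by (simp add: quad_poly_def)

lemma quad_poly_add: "quad_poly (M + N) = quad_poly M + quad_poly N"
  by (simp add: quad_poly_def single_add sum.distrib)

lemma quad_poly_scaleR: "quad_poly (c *\<^sub>R M) = Const c * quad_poly M"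
  by (simp add: quad_poly_def Const_def mult_single sum_distrib_left)

lemma quad_poly_uminus: "quad_poly (- M) = - quad_poly M"
  by (metis add.right_inverse minus_unique quad_poly_0 quad_poly_add)

lemma quad_poly_sum: "quad_poly (sum M I) = (\<Sum>i\<in>I. quad_poly (M i))"
  by (induction I rule: infinite_finite_induct) (simp_all add: quad_poly_0 quad_poly_add)

lemma quad_poly_outer:
  "quad_poly (outer v) = (\<Sum>i\<in>UNIV. Poly_Mapping.single (homog_mon i) (v $ i)) ^ 2"
  by (simp add: quad_poly_def outer_def power2_eq_square sum_product mult_single)

text \<open>A rank-one summand \<open>outer v\<close> becomes the square of the affine polynomial
  with coefficient vector \<open>v\<close>.\<close>

lemma sos_quad_poly:
  assumes "psd M"
  shows "sos (quad_poly M)"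
proof -
  obtain vs where vs: "M = (\<Sum>v\<leftarrow>vs. outer v)"
    using psd_sum_outer[OF assms] by blast
  have "quad_poly (\<Sum>v\<leftarrow>vs. outer v)
    = (\<Sum>v\<leftarrow>vs. (\<Sum>i\<in>UNIV. Poly_Mapping.single (homog_mon i) (v $ i)) ^ 2)"
    by (induction vs) (simp_all add: quad_poly_0 quad_poly_add quad_poly_outer)
  then show ?thesis
    unfolding sos_def vs
    by (intro exI[of _ "map (\<lambda>v. \<Sum>i\<in>UNIV. Poly_Mapping.single (homog_mon i) (v $ i)) vs"])
      (simp add: o_def)
qed

lemma total_degree_quad_poly: "total_degree (quad_poly M) \<le> 2"
proof -
  have deg1: "(\<Sum>k\<in>UNIV. Poly_Mapping.lookup (homog_mon i) k) \<le> 1" for i :: "'a option"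
    by (cases i) (simp_all add: homog_mon_def lookup_single when_def)
  have "(\<Sum>k\<in>UNIV. Poly_Mapping.lookup m k) \<le> 2" if m: "m \<in> Poly_Mapping.keys (quad_poly M)" for m
  proof -
    from m obtain i where "m \<in> Poly_Mapping.keys (\<Sum>j\<in>UNIV. Poly_Mapping.single (homog_mon i + homog_mon j) (M $ i $ j))"
      unfolding quad_poly_def using keys_sum by fast
    then obtain j where "m \<in> Poly_Mapping.keys (Poly_Mapping.single (homog_mon i + homog_mon j) (M $ i $ j))"
      using keys_sum by fast
    then have "m = homog_mon i + homog_mon j"
      by (simp split: if_splits)
    then show ?thesis
      using deg1[of i] deg1[of j] by (simp add: lookup_add sum.distrib)
  qed
  then show ?thesis
    by (auto simp: total_degree_def)
qed

text \<open>Monomials may cancel in a sum, so additivity of \<open>peval\<close> is checked over a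
  common finite set of monomials.\<close>

lemma peval_superset:
  assumes "finite S" "Poly_Mapping.keys p \<subseteq> S"
  shows "peval p x = (\<Sum>m\<in>S. Poly_Mapping.lookup p m * (\<Prod>i\<in>UNIV. x $ i ^ Poly_Mapping.lookup m i))"
  unfolding peval_def using assms
  by (intro sum.mono_neutral_left) (auto simp: in_keys_iff)

lemma peval_add: "peval (p + q) x = peval p x + peval q x"
  using peval_superset[of "Poly_Mapping.keys p \<union> Poly_Mapping.keys q"] keys_add[of p q]
  by (simp add: lookup_add distrib_right sum.distrib)

lemma peval_0: "peval 0 x = 0"
  by (simp add: peval_def)

lemma peval_sum: "peval (sum p I) x = (\<Sum>i\<in>I. peval (p i) x)"
  by (induction I rule: infinite_finite_induct) (simp_all add: peval_0 peval_add)

lemma peval_single: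
  "peval (Poly_Mapping.single m c) x = c * (\<Prod>i\<in>UNIV. x $ i ^ Poly_Mapping.lookup m i)"
  by (simp add: peval_def)

lemma prod_homog_mon:
  "(\<Prod>k\<in>UNIV. x $ k ^ Poly_Mapping.lookup (homog_mon i) k) = homog_vec x $ i"
proof (cases i)
  case (Some l)
  have "x $ k ^ Poly_Mapping.lookup (Poly_Mapping.single l 1) k = (if k = l then x $ l else 1)" for k
    by (simp add: lookup_single when_def)
  then show ?thesis
    using Some by (simp add: homog_mon_def homog_vec_def)
qed (simp add: homog_mon_def homog_vec_def)

lemma peval_quad_poly: "peval (quad_poly M) x = homog_vec x \<bullet> (M *v homog_vec x)"
  by (simp add: quad_poly_def peval_sum peval_single lookup_add power_add prod.distrib
      prod_homog_mon inner_vec_def matrix_vector_mult_def sum_distrib_left ac_simps)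

text \<open>The form vanishes at every \<open>homog_vec x\<close>, so semidefiniteness puts these
  vectors in the kernel of \<open>M\<close>, and they span the whole space. This carries vanishing
  of polynomials back to matrices.\<close>

lemma psd_quad_poly_eq_0:
  assumes "psd M" "quad_poly M = 0"
  shows "M = 0"
proof -
  have ker: "M *v homog_vec x = 0" for x
    using assms by (metis peval_0 peval_quad_poly psd_mult_vec_eq_0)
  have None: "homog_vec 0 = axis None (1::real)"
    by (simp add: vec_eq_iff homog_vec_def axis_def split: option.split)
  have Some: "homog_vec (axis k 1) - homog_vec 0 = axis (Some k) (1::real)" for k :: 'a
    by (auto simp: vec_eq_iff homog_vec_def axis_def split: option.split)
  have "M *v axis j 1 = 0" for j
    by (cases j) (metis None ker, metis Some ker matrix_vector_mult_diff_distrib diff_zero)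
  then show ?thesis
    by (metis inner_axis_matrix inner_zero_right vec_eq_iff zero_index)
qed

lemma sum_UNIV_option:
  "(\<Sum>i\<in>UNIV. f i) = f None + (\<Sum>k\<in>(UNIV :: 'k::finite set). f (Some k))"
  by (simp add: UNIV_option_conv sum.reindex)

section \<open>Concave quadratics and pseudo-expectations\<close>

text \<open>\<open>F\<close> is \<open>A\<close> bordered by \<open>\<alpha>\<close> and
  \<open>a\<close>. The border is invisible to vectors with zero \<open>None\<close> coordinate,
  where the form of \<open>F\<close> is that of \<open>A\<close>.\<close>

lemma concave_quadratic_quad_poly:
  fixes f :: "('n::finite) rpoly"
  assumes "concave_quadratic f"
  obtains F where "transpose F = F" "\<And>z. z $ None = 0 \<Longrightarrow> z \<bullet> (F *v z) \<le> 0" "f = quad_poly F"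
proof -
  obtain A \<alpha> a where A: "negative_semidefinite A"
    and f: "f = (\<Sum>i\<in>UNIV. \<Sum>j\<in>UNIV. Const (A $ i $ j) * Var i * Var j)
            + 2 * (\<Sum>i\<in>UNIV. Const (\<alpha> $ i) * Var i) + Const a"
    using assms unfolding concave_quadratic_def by blast
  define F :: "real ^ 'n option ^ 'n option" where
    "F = (\<chi> i j. case i of
       None \<Rightarrow> (case j of None \<Rightarrow> a | Some l \<Rightarrow> \<alpha> $ l)
     | Some k \<Rightarrow> (case j of None \<Rightarrow> \<alpha> $ k | Some l \<Rightarrow> A $ k $ l))"
  show thesis
  proof
    show "transpose F = F"
      using A by (auto simp: transpose_eq_iff F_def negative_semidefinite_def split: option.split)
    show "f = quad_poly F"
    proof -
      have "Const c * Var k * Var l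
          = Poly_Mapping.single (Poly_Mapping.single k 1 + Poly_Mapping.single l 1) c"
        and "Const c * Var k = Poly_Mapping.single (Poly_Mapping.single k 1) c" for c and k l :: 'n
        by (simp_all add: Const_def Var_def mult_single)
      then show ?thesis
        unfolding f mult_2 quad_poly_def
        by (simp add: sum_UNIV_option F_def homog_mon_def Const_def sum.distrib)
    qed
    show "z \<bullet> (F *v z) \<le> 0" if "z $ None = 0" for z
    proof -
      let ?z = "\<chi> k. z $ Some k"
      have "z \<bullet> (F *v z) = ?z \<bullet> (A *v ?z)"
        using that by (simp add: inner_vec_def matrix_vector_mult_def sum_UNIV_option F_def)
      then show ?thesis
        using A by (simp add: negative_semidefinite_def)
    qed
  qed
qed

text \<open>Jensen's inequality for the pseudo-expectation \<open>M \<mapsto> P \<bullet> M\<close> with mean \<open>y\<close> and total mass \<open>P $ N $ N\<close>.\<close>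
lemma concave_moment_bound:
  fixes F P :: "real ^ 'm ^ 'm" and N :: 'm
  assumes sym: "transpose F = F" and conc: "\<And>z. z $ N = 0 \<Longrightarrow> z \<bullet> (F *v z) \<le> 0"
    and P: "\<And>M. psd M \<Longrightarrow> 0 \<le> P \<bullet> M" and "P $ N $ N > 0"
  defines "y \<equiv> \<chi> j. (P $ N $ j + P $ j $ N) / (2 * P $ N $ N)"
  shows "P \<bullet> F \<le> P $ N $ N * (y \<bullet> (F *v y))"
proof -
  define c u q where "c = P $ N $ N" and "u = F *v y" and "q = y \<bullet> u"
  \<comment> \<open>\<open>P\<close> may be non-symmetric, so \<open>y\<close> averages its row and
    column at \<open>N\<close>.\<close>
  have "c > 0" and y: "P $ N $ j + P $ j $ N = 2 * c * y $ j" for j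
    using \<open>P $ N $ N > 0\<close> by (simp_all add: y_def c_def)
  then have yN: "y $ N = 1"
    by (simp add: y_def c_def)
  have sum_if: "(\<Sum>j\<in>UNIV. if b then h j else 0) = (if b then sum h UNIV else 0)"
    for b and h :: "'m \<Rightarrow> real"
    by simp
  \<comment> \<open>\<open>F + W\<close> represents the tangent of \<open>F\<close> at \<open>y\<close>, on which \<open>P\<close> acts as \<open>c\<close> times evaluation at \<open>y\<close>.\<close>
  define W :: "real ^ 'm ^ 'm" where
    "W = (\<chi> i j. (if i = N then u $ j else 0) + (if j = N then u $ i else 0)
       - (if i = N then if j = N then q else 0 else 0) - F $ i $ j)"
  \<comment> \<open>Since \<open>y $ N = 1\<close>, subtracting \<open>z $ N\<close> times
    \<open>y\<close> clears the \<open>N\<close> coordinate, and \<open>conc\<close> then makes the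
    form of \<open>W\<close> nonnegative.\<close>
  have "z \<bullet> (W *v z) = - ((z + (- z $ N) *\<^sub>R y) \<bullet> (F *v (z + (- z $ N) *\<^sub>R y)))" for z
  proof -
    have "W *v z = (u \<bullet> z) *\<^sub>R axis N 1 + z $ N *\<^sub>R u - (q * z $ N) *\<^sub>R axis N 1 - F *v z"
      by (simp add: vec_eq_iff W_def matrix_vector_mult_def inner_vec_def axis_def
          algebra_simps sum.distrib sum_subtractf if_distrib[of "\<lambda>t. _ * t"] cong: if_cong)
    then have "z \<bullet> (W *v z) = 2 * z $ N * (u \<bullet> z) - q * (z $ N)\<^sup>2 - z \<bullet> (F *v z)"
      by (simp add: inner_diff_right inner_add_right inner_axis inner_commute power2_eq_square)
    then show ?thesis
      unfolding inner_symmetric_matrix_combination[OF sym]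
      by (simp add: u_def q_def inner_symmetric_matrix[OF sym, of y z] inner_commute)
  qed
  then have "psd W"
    using conc sym yN by (simp add: psd_def transpose_eq_iff) (simp add: W_def)
  then have "P \<bullet> F \<le> P \<bullet> (F + W)"
    using P by (simp add: inner_add_right)
  also have "\<dots> = (\<Sum>j\<in>UNIV. (P $ N $ j + P $ j $ N) * u $ j) - c * q"
    by (simp add: sum_if inner_vec_def W_def c_def algebra_simps sum.distrib sum_subtractf
        if_distrib[of "\<lambda>t. _ * t"] cong: if_cong)
  \<comment> \<open>The sum equals \<open>2 * c * q\<close>, twice the term subtracted from
    it.\<close>
  also have "\<dots> = c * q"
    by (simp only: y) (simp add: q_def inner_vec_def sum_distrib_left ac_simps)
  finally show ?thesis
    by (simp add: c_def q_def u_def)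
qed

section \<open>Separation of \<open>D\<close> from \<open>C\<close> and the resulting
  identity\<close>

theorem theorem3:
  fixes f g :: "nat \<Rightarrow> ('n::finite) rpoly" and r s :: nat
  assumes f_cq: "\<And>i. i \<in> {1..r} \<Longrightarrow> concave_quadratic (f i)"
    and g_cq: "\<And>j. j \<in> {1..s} \<Longrightarrow> concave_quadratic (g j)"
    and K_empty: "{x :: real ^ 'n. (\<forall>i\<in>{1..r}. peval (f i) x \<ge> 0) \<and>
                                    (\<forall>j\<in>{1..s}. peval (g j) x > 0)} = {}"
    and no_sos: "\<not> (\<exists>\<delta> :: nat \<Rightarrow> real. (\<forall>i\<in>{1..r}. \<delta> i \<ge> 0) \<and>
                     - (\<Sum>i=1..r. Const (\<delta> i) * f i) \<noteq> 0 \<and>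
                     sos (- (\<Sum>i=1..r. Const (\<delta> i) * f i)))"
  shows "\<exists>(lam :: nat \<Rightarrow> real) (\<eta> :: nat \<Rightarrow> real) (h :: 'n rpoly).
           (\<forall>i\<in>{1..r}. lam i \<ge> 0) \<and> (\<forall>j\<in>{0..s}. \<eta> j \<ge> 0) \<and>
           sos h \<and> total_degree h \<le> 2 \<and>
           (\<Sum>i=1..r. Const (lam i) * f i) + (\<Sum>j=1..s. Const (\<eta> j) * g j)
             + Const (\<eta> 0) + h = 0 \<and>
           (\<Sum>j=0..s. \<eta> j) = 1"
proof -
  define conc where "conc M \<longleftrightarrow> transpose M = M \<and> (\<forall>z. z $ None = 0 \<longrightarrow> z \<bullet> (M *v z) \<le> 0)"
    for M :: "real ^ 'n option ^ 'n option"
  have "\<exists>F. conc F \<and> p = quad_poly F" if "concave_quadratic p" for p :: "'n rpoly"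
    by (rule concave_quadratic_quad_poly[OF that]) (auto simp: conc_def)
  then have "\<forall>i\<in>{1..r}. \<exists>F. conc F \<and> f i = quad_poly F" "\<forall>j\<in>{1..s}. \<exists>G. conc G \<and> g j = quad_poly G"
    using f_cq g_cq by blast+
  then obtain F G where F: "\<And>i. i \<in> {1..r} \<Longrightarrow> conc (F i) \<and> f i = quad_poly (F i)"
    and G: "\<And>j. j \<in> {1..s} \<Longrightarrow> conc (G j) \<and> g j = quad_poly (G j)"
    unfolding bchoice_iff by blast
  define E :: "real ^ 'n option ^ 'n option" where "E = outer (axis None 1)"
  have E: "quad_poly E = Const 1" "P \<bullet> E = P $ None $ None" for P
    by (simp_all add: E_def outer_def quad_poly_def sum_UNIV_option axis_def homog_mon_def
        Const_def inner_vec_def)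
  \<comment> \<open>Index 0 carries the constant polynomial 1, so that \<open>\<eta> 0\<close> is
    one of the convex weights.\<close>
  define G' where "G' j = (if j = 0 then E else G j)" for j
  let ?A = "convex_cone hull (F ` {1..r})" and ?B = "{M :: real ^ 'n option ^ 'n option. psd M}"
  define C where "C = {a + b |a b. a \<in> ?A \<and> b \<in> ?B}"
  define D where "D = convex hull ((\<lambda>j. - G' j) ` {0..s})"
  have Q_cone: "quad_poly (\<Sum>i=1..r. c i *\<^sub>R F i) = (\<Sum>i=1..r. Const (c i) * f i)" for c
    using F by (simp add: quad_poly_sum quad_poly_scaleR)
  have coneA: "M \<in> {\<Sum>i=1..r. c i *\<^sub>R F i |c. \<forall>i\<in>{1..r}. 0 \<le> c i}" if "M \<in> ?A" for M
    using convex_cone_hull_image_subset[of "{1..r}" F] that by blast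
  \<comment> \<open>This is where \<open>no_sos\<close> enters: \<open>- M\<close> yields a sum of
    squares of the excluded shape, so its polynomial vanishes. It supplies the condition under which
    the sum of cones \<open>C\<close> is closed.\<close>
  have trivial: "M = 0" if M: "M \<in> ?A" "- M \<in> ?B" for M
  proof -
    obtain c where c: "M = (\<Sum>i=1..r. c i *\<^sub>R F i)" "\<forall>i\<in>{1..r}. 0 \<le> c i"
      using coneA[OF M(1)] by blast
    have eq: "quad_poly (- M) = - (\<Sum>i=1..r. Const (c i) * f i)"
      by (simp only: c(1) quad_poly_uminus Q_cone)
    have "sos (quad_poly (- M))"
      using M by (simp add: sos_quad_poly)
    then have "quad_poly (- M) = 0"
      using no_sos c(2) unfolding eq by blast
    then show ?thesis
      using psd_quad_poly_eq_0[of "- M"] M by simp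
  qed
  have "C = (\<Union>a\<in>?A. \<Union>b\<in>?B. {a + b})"
    unfolding C_def by blast
  then have cone: "convex_cone C"
    using convex_cone_sums[OF convex_cone_convex_cone_hull convex_cone_psd] by metis
  have "conic ?A" "conic ?B"
    using convex_cone_convex_cone_hull convex_cone_psd by (metis convex_cone_def)+
  moreover have "closed ?A"
    by (rule closed_convex_cone_hull) simp
  ultimately have "closed C"
    unfolding C_def by (intro closed_conic_sums closed_psd trivial)
  have "D \<inter> C \<noteq> {}"
  proof
    assume "D \<inter> C = {}"
    moreover have "convex D" "compact D" "D \<noteq> {}"
      by (simp_all add: D_def compact_convex_hull finite_imp_compact)
    moreover have "convex C"
      using cone by (simp add: convex_cone_def)
    ultimately obtain P b where D: "\<And>x. x \<in> D \<Longrightarrow> P \<bullet> x < b" and C: "\<And>x. x \<in> C \<Longrightarrow> b < P \<bullet> x"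
      using \<open>closed C\<close> separating_hyperplane_compact_closed[of D C] by metis
    have "b < 0"
      using C convex_cone_contains_0[OF cone] by fastforce
    \<comment> \<open>A negative value could be rescaled within the cone to equal \<open>b\<close>,
      against the strict separation.\<close>
    have C0: "0 \<le> P \<bullet> x" if "x \<in> C" for x
    proof (rule ccontr)
      assume "\<not> 0 \<le> P \<bullet> x"
      then show False
        using C[of "(b / (P \<bullet> x)) *\<^sub>R x"] convex_cone_scaleR[OF cone _ that, of "b / (P \<bullet> x)"] \<open>b < 0\<close>
        by (simp add: divide_nonpos_nonpos)
    qed
    have PF: "0 \<le> P \<bullet> F i" if "i \<in> {1..r}" for i
    proof -
      have "F i + 0 \<in> C"
        unfolding C_def using that convex_cone_contains_0[OF convex_cone_psd]
        by (blast intro: hull_inc)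
      then show ?thesis
        using C0 by simp
    qed
    have Ppsd: "0 \<le> P \<bullet> M" if "psd M" for M
    proof -
      have "0 + M \<in> C"
        unfolding C_def using that convex_cone_hull_contains_0 by blast
      then show ?thesis
        using C0 by simp
    qed
    have PG: "0 < P \<bullet> G' j" if "j \<in> {0..s}" for j
    proof -
      have "- G' j \<in> D"
        unfolding D_def using that by (blast intro: hull_inc)
      then show ?thesis
        using D[of "- G' j"] \<open>b < 0\<close> by simp
    qed
    define c where "c = P $ None $ None"
    \<comment> \<open>\<open>c\<close> is the value of the functional at the constant 1, which is
      positive because \<open>- E\<close> lies in \<open>D\<close>.\<close>
    have "c > 0"
      using PG[of 0] by (simp add: G'_def E c_def)
    define y where "y = (\<chi> j. (P $ None $ j + P $ j $ None) / (2 * c))"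
    define x where "x = (\<chi> k. y $ Some k)"
    have y: "homog_vec x = y"
      using \<open>c > 0\<close> by (simp add: vec_eq_iff homog_vec_def x_def y_def c_def split: option.split)
    \<comment> \<open>The mean \<open>y\<close> has \<open>None\<close> coordinate 1, so it comes
      from a genuine point \<open>x\<close>, and the form of \<open>M\<close> at \<open>y\<close> is
      the value of the polynomial at \<open>x\<close>.\<close>
    have bound: "P \<bullet> M \<le> c * peval (quad_poly M) x" if "conc M" for M
      using concave_moment_bound[of M None P] that Ppsd \<open>c > 0\<close>
      by (simp add: conc_def peval_quad_poly y c_def y_def)
    have "peval (f i) x \<ge> 0" if "i \<in> {1..r}" for i
      using bound[of "F i"] F[OF that] PF[OF that] \<open>c > 0\<close>
      by (metis order_trans zero_le_mult_iff not_le)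
    moreover have "peval (g j) x > 0" if "j \<in> {1..s}" for j
      using bound[of "G j"] G[OF that] PG[of j] that \<open>c > 0\<close>
      by (simp add: G'_def) (metis less_le_trans zero_less_mult_pos)
    ultimately show False
      using K_empty by blast
  qed
  \<comment> \<open>A common point is both minus a convex combination of the \<open>G'\<close> and a
    cone combination of the \<open>F\<close> plus a semidefinite \<open>H\<close>; equating the two
    gives the required identity with \<open>quad_poly H\<close> as the sum of squares.\<close>
  then obtain M where "M \<in> D" "M \<in> C" by blast
  obtain \<eta> where \<eta>: "M = (\<Sum>j=0..s. \<eta> j *\<^sub>R - G' j)" "\<forall>j\<in>{0..s}. 0 \<le> \<eta> j" "sum \<eta> {0..s} = 1"
    using convex_hull_image_subset[of "{0..s}" "\<lambda>j. - G' j"] \<open>M \<in> D\<close> unfolding D_def by blast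
  obtain a H where H: "M = a + H" "a \<in> ?A" "psd H"
    using \<open>M \<in> C\<close> unfolding C_def by blast
  obtain lam where lam: "a = (\<Sum>i=1..r. lam i *\<^sub>R F i)" "\<forall>i\<in>{1..r}. 0 \<le> lam i"
    using coneA[OF H(2)] by blast
  have "quad_poly (\<Sum>j=0..s. \<eta> j *\<^sub>R G' j) = (\<Sum>j=1..s. Const (\<eta> j) * g j) + Const (\<eta> 0)"
  proof -
    have "quad_poly (\<Sum>j=0..s. \<eta> j *\<^sub>R G' j) = (\<Sum>j=0..s. Const (\<eta> j) * quad_poly (G' j))"
      by (simp add: quad_poly_sum quad_poly_scaleR)
    also have "\<dots> = Const (\<eta> 0) * quad_poly (G' 0) + (\<Sum>j=1..s. Const (\<eta> j) * quad_poly (G' j))"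
      by (simp add: sum.atLeast_Suc_atMost)
    also have "Const (\<eta> 0) * quad_poly (G' 0) = Const (\<eta> 0)"
      by (simp add: G'_def E Const_def mult_single)
    finally show ?thesis
      using G by (simp add: G'_def)
  qed
  moreover have "a + (\<Sum>j=0..s. \<eta> j *\<^sub>R G' j) + H = 0"
    using \<eta>(1) H(1) by (simp add: sum_negf add.assoc eq_neg_iff_add_eq_0) (metis add.assoc add.commute)
  ultimately have "(\<Sum>i=1..r. Const (lam i) * f i) + (\<Sum>j=1..s. Const (\<eta> j) * g j)
             + Const (\<eta> 0) + quad_poly H = 0"
    by (metis (no_types, lifting) Q_cone add.assoc lam(1) quad_poly_0 quad_poly_add)
  then show ?thesis
    using lam(2) \<eta>(2,3) sos_quad_poly[OF H(3)] total_degree_quad_poly[of H] by blast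
qed

end
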